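(* The matching number is stable under 2-switch: for every graph $G$ and every 2-switch $\tau$, $|\mu(\tau(G))-\mu(G)|\le 1$.
   Context: Graphs are finite, simple, undirected and labeled. $\mu(G)$ is the maximum cardinality of a set of pairwise disjoint edges of $G$. For vertices $a,b,c,d$, the 2-switch $\tau=\binom{a\ b}{c\ d}$ maps $G$ to $G-ab-cd+ac+bd$ if $ab,cd\in E(G)$, $\{a,b\}\cap\{c,d\}=\varnothing$ and $ac,bd\notin E(G)$, and to $G$ otherwise. *)

theory Defs
  imports Main
begin

text \<open>
  Graphs are given by a vertex set and a set of edges, where an edge is an unordered pair
  of distinct vertices, i.e. a two-element set of vertices.  Vertices are labels
  from an arbitrary type, and graphs are not identified up to isomorphism.
\<close>

record 'a sgraph =
  verts :: "'a set"
  edges :: "'a set set"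

definition simple_graph :: "'a sgraph \<Rightarrow> bool" where
  "simple_graph G \<longleftrightarrow> finite (verts G) \<and> (\<forall>e \<in> edges G. e \<subseteq> verts G \<and> card e = 2)"

definition matching :: "'a sgraph \<Rightarrow> 'a set set \<Rightarrow> bool" where
  "matching G M \<longleftrightarrow> M \<subseteq> edges G \<and> pairwise disjnt M"

definition matching_number :: "'a sgraph \<Rightarrow> nat" where
  "matching_number G = Max (card ` {M. matching G M})"

text \<open>
  The operation written as the array with rows \<open>a b\<close> and \<open>c d\<close>: it replaces the edges
  \<open>ab\<close>, \<open>cd\<close> by \<open>ac\<close>, \<open>bd\<close> where this is admissible, and otherwise leaves the graph unchanged.
\<close>

definition two_switch :: "'a \<Rightarrow> 'a \<Rightarrow> 'a \<Rightarrow> 'a \<Rightarrow> 'a sgraph \<Rightarrow> 'a sgraph" where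
  "two_switch a b c d G =
     (if {a, b} \<in> edges G \<and> {c, d} \<in> edges G \<and> {a, b} \<inter> {c, d} = {} \<and>
         {a, c} \<notin> edges G \<and> {b, d} \<notin> edges G
      then G\<lparr>edges := (edges G - {{a, b}, {c, d}}) \<union> {{a, c}, {b, d}}\<rparr>
      else G)"

lemma finite_edges:
  assumes "simple_graph G"
  shows "finite (edges G)"
proof -
  have "edges G \<subseteq> Pow (verts G)"
    using assms by (auto simp: simple_graph_def)
  then show ?thesis
    using assms by (metis finite_Pow_iff finite_subset simple_graph_def)
qed

text \<open>The maximum defining the matching number of a graph is taken over a finite nonempty set.\<close>

lemma finite_matchings:
  assumes "simple_graph G"
  shows "finite {M. matching G M}"
  by (rule finite_subset[of _ "Pow (edges G)"])
     (use finite_edges[OF assms] in \<open>auto simp: matching_def\<close>)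

lemma matching_empty: "matching G {}"
  by (simp add: matching_def)

lemma simple_graph_two_switch:
  assumes "simple_graph G"
  shows "simple_graph (two_switch a b c d G)"
  using assms by (auto simp: simple_graph_def two_switch_def card_insert_if)

end

theory Submission
  imports Defs
begin

lemma card_le_matching_number:
  assumes "simple_graph G" "matching G M"
  shows "card M \<le> matching_number G"
  unfolding matching_number_def
  by (rule Max_ge) (use assms finite_matchings[OF assms(1)] in auto)

lemma obtain_maximum_matching:
  assumes "simple_graph G"
  obtains M where "matching G M" "card M = matching_number G"
proof -
  have "matching_number G \<in> card ` {M. matching G M}"
    unfolding matching_number_def
    by (rule Max_in) (use finite_matchings[OF assms] matching_empty[of G] in auto)
  then show thesis
    using that by auto
qed

text \<open>
  A maximum matching that avoids one of the deleted edges loses at most the other one.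
  If it contains both, they can be exchanged for the two new edges, which cover the same
  four vertices.
\<close>

lemma matching_number_le_Suc_exchange:
  assumes G: "simple_graph G" and H: "simple_graph H"
    and sub: "edges G - {{a, b}, {c, d}} \<subseteq> edges H"
    and new: "{a, c} \<in> edges H" "{b, d} \<in> edges H"
    and disj: "{a, b} \<inter> {c, d} = {}"
  shows "matching_number G \<le> Suc (matching_number H)"
proof -
  obtain M where M: "matching G M" and card_M: "card M = matching_number G"
    using obtain_maximum_matching[OF G] .
  have ME: "M \<subseteq> edges G" and pw: "pairwise disjnt M"
    using M by (auto simp: matching_def)
  have fin: "finite M"
    using finite_subset[OF ME finite_edges[OF G]] .
  show ?thesis
  proof (cases "{a, b} \<in> M \<and> {c, d} \<in> M")
    case True
    then have "{a, b} \<in> edges G" "{c, d} \<in> edges G"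
      using ME by auto
    then have ne: "a \<noteq> b" "c \<noteq> d"
      using G by (auto simp: simple_graph_def)
    define N where "N = M - {{a, b}, {c, d}}"
    \<comment> \<open>Both \<open>{a, b}\<close> and \<open>{c, d}\<close> lie in \<open>M\<close>,
      so disjointness keeps every other edge of \<open>M\<close> away from all four
      vertices.\<close>
    have avoid: "a \<notin> e \<and> b \<notin> e \<and> c \<notin> e \<and> d \<notin> e" if "e \<in> N" for e
      using that True pairwiseD[OF pw, of e "{a, b}"] pairwiseD[OF pw, of e "{c, d}"]
      by (auto simp: N_def disjnt_def)
    have "pairwise disjnt N"
      using pw by (rule pairwise_subset) (auto simp: N_def)
    \<comment> \<open>The new edges miss \<open>N\<close> by \<open>avoid\<close>. They miss each
      other because \<open>ne\<close> separates \<open>a\<close> from \<open>b\<close> and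
      \<open>c\<close> from \<open>d\<close>, while \<open>disj\<close> separates \<open>a\<close>
      from \<open>d\<close> and \<open>c\<close> from \<open>b\<close>.\<close>
    then have "pairwise disjnt ({{a, c}, {b, d}} \<union> N)"
      using avoid ne disj by (auto simp: pairwise_insert disjnt_def)
    moreover have "N \<subseteq> edges H"
      using ME sub by (auto simp: N_def)
    ultimately have "matching H ({{a, c}, {b, d}} \<union> N)"
      using new by (auto simp: matching_def)
    moreover have "card ({{a, c}, {b, d}} \<union> N) = card M"
    proof -
      have finN: "finite N"
        using fin by (simp add: N_def)
      have "M = {{a, b}, {c, d}} \<union> N" "{{a, b}, {c, d}} \<inter> N = {}"
        using True by (auto simp: N_def)
      then have "card M = card {{a, b}, {c, d}} + card N"
        using finN by (simp only: card_Un_disjoint finite.intros)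
      moreover have "{{a, c}, {b, d}} \<inter> N = {}"
        using avoid by blast
      then have "card ({{a, c}, {b, d}} \<union> N) = card {{a, c}, {b, d}} + card N"
        using finN by (simp only: card_Un_disjoint finite.intros)
      \<comment> \<open>Each pair of edges really has two members, so trading one pair for the other
        keeps the cardinality: in this case the matching loses nothing.\<close>
      moreover have "{a, b} \<noteq> {c, d}" "{a, c} \<noteq> {b, d}"
        using disj ne by (auto simp: doubleton_eq_iff)
      ultimately show ?thesis
        by simp
    qed
    ultimately show ?thesis
      using card_le_matching_number[OF H] card_M by fastforce
  next
    case False
    \<comment> \<open>If \<open>{a, b}\<close> is not in \<open>M\<close>, take
      \<open>{c, d}\<close> for \<open>e\<close>; otherwise take \<open>{a, b}\<close>. The chosen
      \<open>e\<close> need not belong to \<open>M\<close>, so removing it costs one edge or none;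
      this possible loss is the \<open>Suc\<close>.\<close>
    then obtain e where "M - {e} \<subseteq> edges H"
      using ME sub by blast
    moreover have "pairwise disjnt (M - {e})"
      using pw by (rule pairwise_subset) auto
    ultimately have "card (M - {e}) \<le> matching_number H"
      by (intro card_le_matching_number[OF H]) (simp add: matching_def)
    then show ?thesis
      using card_M card_Diff1_le[of M e] fin by (auto simp: card_Diff_singleton_if split: if_splits)
  qed
qed

theorem theorem9:
  fixes G :: "'a sgraph" and a b c d :: 'a
  assumes "simple_graph G"
    and "a \<in> verts G" and "b \<in> verts G" and "c \<in> verts G" and "d \<in> verts G"
  shows "\<bar>int (matching_number (two_switch a b c d G)) - int (matching_number G)\<bar> \<le> 1"
proof (cases "{a, b} \<in> edges G \<and> {c, d} \<in> edges G \<and> {a, b} \<inter> {c, d} = {} \<and>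
         {a, c} \<notin> edges G \<and> {b, d} \<notin> edges G")
  case True
  define H where "H = two_switch a b c d G"
  have H: "simple_graph H"
    using simple_graph_two_switch[OF assms(1)] by (simp add: H_def)
  have edges_H: "edges H = (edges G - {{a, b}, {c, d}}) \<union> {{a, c}, {b, d}}"
    using True by (simp add: H_def two_switch_def)
  have "a \<noteq> b" "c \<noteq> d"
    using True assms(1) by (auto simp: simple_graph_def)
  \<comment> \<open>This is the disjointness condition for the switch that leads back from
    \<open>H\<close> to \<open>G\<close>.\<close>
  then have "{a, c} \<inter> {b, d} = {}"
    using True by auto
  \<comment> \<open>The same exchange argument covers this direction: swapping the roles of
    \<open>b\<close> and \<open>c\<close> gives the inverse switch, which deletes \<open>ac\<close>,
    \<open>bd\<close> from \<open>H\<close> and restores \<open>ab\<close>,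
    \<open>cd\<close>.\<close>
  then have "matching_number H \<le> Suc (matching_number G)"
    using True edges_H by (intro matching_number_le_Suc_exchange[OF H assms(1), of a c b d]) auto
  moreover have "matching_number G \<le> Suc (matching_number H)"
    using True edges_H by (intro matching_number_le_Suc_exchange[OF assms(1) H, of a b c d]) auto
  ultimately show ?thesis
    unfolding H_def by linarith
next
  case False
  then have "two_switch a b c d G = G"
    unfolding two_switch_def by (rule if_not_P)
  then show ?thesis
    by simp
qed

end
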